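(* Let all $k_i$ be integers with $k_i\geq 1$ (and $m\ge 1$). Then \[ \begin{array}{rll} \mathcal{F}(\infty) & = & 2, \\ \mathcal{F}(\infty,k_1,k_2,\ldots,k_{m-1},k_m,\infty) & = & \mathcal{F}(1,k_1,k_2,\ldots,k_{m-1},k_m,1), \\ \mathcal{F}(\infty,k_1,k_2,k_3,\ldots) & = & \infty, \\ \mathcal{F}(\ldots,k_{-3},k_{-2},k_{-1},\infty) & = & \infty, \\ \mathcal{F}(\ldots,k_{-3},k_{-2},k_{-1},k_0,k_1,k_2,k_3,\ldots) & = & \infty, \end{array} \] where the value $\infty$ means that the network has infinitely many fixed points.
   Context: Finite open chain AND-OR networks. For $n\ge 2$ and operators $\diamondsuit_2,\ldots,\diamondsuit_{n-1}\in\{\wedge,\vee\}$ (logical AND, OR), the AND-OR network with open chain topology is $f=(f_1,\ldots,f_n):\{0,1\}^n\to\{0,1\}^n$ with $f_1(x)=x_2$, $f_i(x)=x_{i-1}\diamondsuit_i x_{i+1}$ for $2\le i\le n-1$, and $f_n(x)=x_{n-1}$. For positive integers $k_1,\ldots,k_m$ with $k_1+\cdots+k_m=n-2$, the finite sequence $(k_1,\ldots,k_m)$ represents the network whose operator sequence $\diamondsuit_2,\ldots,\diamondsuit_{n-1}$ consists of $m$ consecutive runs of lengths $k_1,\ldots,k_m$, the operator being constant in each run and alternating between $\wedge$ and $\vee$ from one run to the next. $\mathcal{F}(k_1,\ldots,k_m)$ is its number of fixed points ($x$ with $f(x)=x$). Infinite chain AND-OR networks. These have variables $x_i\in\{0,1\}$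 indexed by $i\in\mathbb{Z}$ and coordinate functions $f_i(x)=x_{i-1}\diamondsuit_i x_{i+1}$ with $\diamondsuit_i\in\{\wedge,\vee\}$ for every $i\in\mathbb{Z}$. A fixed point is an $x\in\{0,1\}^{\mathbb{Z}}$ with $f_i(x)=x_i$ for all $i$. Such a network is represented by the sequence of lengths of the maximal runs of equal consecutive operators, listed from left to right (operators alternate between $\wedge$ and $\vee$ from run to run); run lengths may be $\infty$. Thus $(\infty)$ means all operators are equal; $(\infty,k_1,\ldots,k_m,\infty)$ means a left-infinite run, then finite runs of lengths $k_1,\ldots,k_m$, then a right-infinite run; $(\infty,k_1,k_2,\ldots)$ means a left-infinite run followed by infinitely many finite runs; $(\ldots,k_{-2},k_{-1},\infty)$ means infinitely many finite runs extending to the left followed by a right-infinite run; $(\ldots,k_{-1},k_0,k_1,\ldots)$ means all runs are finite, with infinitely many in both directions. $\mathcal{F}$ of such a sequence denotes the number of fixed points of the corresponding network. In all cases the number of fixed points does not depend on which of the two operators is used in a given run (the other runs being determined by alternation). *)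

theory Defs
  imports "HOL-Library.Extended_Nat" "HOL-Library.FuncSet"
begin

datatype operator = AND | OR

fun apply_op :: "operator \<Rightarrow> bool \<Rightarrow> bool \<Rightarrow> bool" where
  "apply_op AND a b = (a \<and> b)"
| "apply_op OR a b = (a \<or> b)"

fun dual_op :: "operator \<Rightarrow> operator" where
  "dual_op AND = OR"
| "dual_op OR = AND"

definition ecard :: "'a set \<Rightarrow> enat" where
  "ecard A = (if finite A then enat (card A) else \<infinity>)"

definition num_fixed_points :: "'s set \<Rightarrow> ('s \<Rightarrow> 's) \<Rightarrow> enat" where
  "num_fixed_points X f = ecard {x \<in> X. f x = x}"

text \<open>The state space \<open>{0,1}\<^sup>n\<close> is rendered as the extensional functions on \<open>{1..n}\<close>;
  only the values of \<open>op\<close> on \<open>{2..n - 1}\<close> are used.\<close>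

definition open_chain_states :: "nat \<Rightarrow> (nat \<Rightarrow> bool) set" where
  "open_chain_states n = {1..n} \<rightarrow>\<^sub>E UNIV"

definition open_chain :: "nat \<Rightarrow> (nat \<Rightarrow> operator) \<Rightarrow> (nat \<Rightarrow> bool) \<Rightarrow> (nat \<Rightarrow> bool)" where
  "open_chain n op x = (\<lambda>i\<in>{1..n}.
     if i = 1 then x 2
     else if i = n then x (n - 1)
     else apply_op (op i) (x (i - 1)) (x (i + 1)))"

fun run_operators :: "operator \<Rightarrow> nat list \<Rightarrow> operator list" where
  "run_operators a [] = []"
| "run_operators a (k # ks) = replicate k a @ run_operators (dual_op a) ks"

text \<open>\<open>\<F>(k\<^sub>1, \<dots>, k\<^sub>m)\<close>, where the first run consists of the operator \<open>a\<close>.  The chain has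
  \<open>k\<^sub>1 + \<dots> + k\<^sub>m + 2\<close> variables, and the list of operators starts with that of variable 2.\<close>

definition open_chain_F :: "operator \<Rightarrow> nat list \<Rightarrow> enat" where
  "open_chain_F a ks =
     (let n = sum_list ks + 2
      in num_fixed_points (open_chain_states n)
           (open_chain n (\<lambda>i. run_operators a ks ! (i - 2))))"

definition infinite_chain :: "(int \<Rightarrow> operator) \<Rightarrow> (int \<Rightarrow> bool) \<Rightarrow> (int \<Rightarrow> bool)" where
  "infinite_chain op x = (\<lambda>i. apply_op (op i) (x (i - 1)) (x (i + 1)))"

definition infinite_chain_F :: "(int \<Rightarrow> operator) \<Rightarrow> enat" where
  "infinite_chain_F op = num_fixed_points UNIV (infinite_chain op)"

definition is_run :: "(int \<Rightarrow> operator) \<Rightarrow> int set \<Rightarrow> bool" where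
  "is_run op R \<longleftrightarrow> R \<noteq> {} \<and> (\<forall>a\<in>R. \<forall>b\<in>R. {a..b} \<subseteq> R \<and> op a = op b)"

definition is_maximal_run :: "(int \<Rightarrow> operator) \<Rightarrow> int set \<Rightarrow> bool" where
  "is_maximal_run op R \<longleftrightarrow> is_run op R \<and> (\<forall>R'. is_run op R' \<and> R \<subseteq> R' \<longrightarrow> R' = R)"

text \<open>The lengths of the maximal runs of \<open>op\<close>, listed from left to right, form the sequence
  \<open>(\<kappa> j)\<close> with index \<open>j\<close> running through \<open>J\<close>; values of \<open>\<kappa>\<close> outside \<open>J\<close> play no role.  The
  sequence only determines the network up to translation and exchange of AND with OR.\<close>

definition has_run_lengths :: "(int \<Rightarrow> operator) \<Rightarrow> int set \<Rightarrow> (int \<Rightarrow> enat) \<Rightarrow> bool" where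
  "has_run_lengths op J \<kappa> \<longleftrightarrow>
     (\<exists>R. bij_betw R J {S. is_maximal_run op S}
        \<and> (\<forall>i\<in>J. \<forall>j\<in>J. i < j \<longrightarrow> (\<forall>a\<in>R i. \<forall>b\<in>R j. a < b))
        \<and> (\<forall>j\<in>J. ecard (R j) = \<kappa> j))"

end

theory Submission imports Defs begin

text \<open>
  The proof rests on two local observations about the fixed points of an infinite chain.

  First, two neighbouring variables with the same operator have the same value in every fixed point
  (\<open>fixed_point_eq_if_op_eq\<close>), so a fixed point is constant on every run.  On a single run occupying all of
  \<open>\<int>\<close> this leaves only the two constant states, which are fixed points of every network.  An
  infinite run at an end of the chain therefore carries as much information as a run of length one
  followed by an end variable that copies it: an end variable of an open chain is equal to its only
  neighbour, so it behaves like the continuation of a constant run.  Hence, if all operators up to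
  \<open>a\<close> agree and all operators from \<open>b\<close> on agree, restriction of states to the window from
  \<open>a - 1\<close> to \<open>b + 1\<close> is a bijection from the fixed points of the infinite chain to those of the open
  chain (\<open>infinite_chain_F_eq_window\<close>).  As negation of all variables exchanges the two operators,
  it does not matter which operator comes first.

  Second, every place \<open>p\<close> where the operators at \<open>p\<close> and \<open>p + 1\<close> differ yields a fixed point with a
  single jump, located between \<open>p\<close> and \<open>p + 1\<close>: the value \<open>1\<close> lies on the side of the OR.  Both
  variables at the jump see one neighbour of each value, and each operator then returns the value
  on its own side.  Distinct places give distinct fixed points, so infinitely many runs
  force infinitely many fixed points (\<open>infinite_chain_F_infinite\<close>).

  The link between maximal runs and changes of operator is that the maximal runs
  are precisely the sets of positions having the same changes to their left
  (\<open>maximal_runs_eq_fibres\<close>).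
\<close>

section \<open>Maximal runs and changes of operator\<close>

definition op_changes :: "(int \<Rightarrow> operator) \<Rightarrow> int set" where
  "op_changes op = {p. op p \<noteq> op (p + 1)}"

definition changes_before :: "(int \<Rightarrow> operator) \<Rightarrow> int \<Rightarrow> int set" where
  "changes_before op i = {p \<in> op_changes op. p < i}"

lemma op_const_if_no_change:
  fixes i j :: int
  assumes "i \<le> j" and "\<And>p. i \<le> p \<Longrightarrow> p < j \<Longrightarrow> op p = op (p + 1)"
  shows "op j = op i"
  using assms
proof (induction j rule: int_ge_induct)
  case base
  show ?case by simp
next
  case (step j)
  have "op j = op i" using step by simp
  moreover have "op j = op (j + 1)" using step by simp
  ultimately show ?case by simp
qed

lemma changes_before_eq_iff_le:
  assumes "i \<le> j"
  shows "changes_before op i = changes_before op j \<longleftrightarrow> (\<exists>c. \<forall>l\<in>{i..j}. op l = c)"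
proof
  assume eq: "changes_before op i = changes_before op j"
  have nochange: "op p = op (p + 1)" if "i \<le> p" "p < j" for p
  proof (rule ccontr)
    assume "op p \<noteq> op (p + 1)"
    then have "p \<in> changes_before op j"
      using that by (simp add: changes_before_def op_changes_def)
    then have "p \<in> changes_before op i" using eq by simp
    then show False using that by (simp add: changes_before_def)
  qed
  have "\<forall>l\<in>{i..j}. op l = op i"
  proof
    fix l assume "l \<in> {i..j}"
    then have "i \<le> l" "l \<le> j" by auto
    from this(1) show "op l = op i"
    proof (rule op_const_if_no_change)
      show "op p = op (p + 1)" if "i \<le> p" "p < l" for p
        by (rule nochange) (use that \<open>l \<le> j\<close> in auto)
    qed
  qed
  then show "\<exists>c. \<forall>l\<in>{i..j}. op l = c" by (rule exI)
next
  assume "\<exists>c. \<forall>l\<in>{i..j}. op l = c"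
  then obtain c where const: "\<And>l. l \<in> {i..j} \<Longrightarrow> op l = c" by blast
  have "p < i" if "p \<in> op_changes op" "p < j" for p
  proof (rule ccontr)
    assume "\<not> p < i"
    then have "op p = c" "op (p + 1) = c" using const that by auto
    then show False using that by (simp add: op_changes_def)
  qed
  then have "{p \<in> op_changes op. p < j} \<subseteq> {p \<in> op_changes op. p < i}" by blast
  moreover have "{p \<in> op_changes op. p < i} \<subseteq> {p \<in> op_changes op. p < j}"
    using assms by auto
  ultimately show "changes_before op i = changes_before op j"
    by (simp add: changes_before_def)
qed

lemma changes_before_eq_if_in_run:
  assumes "is_run op S" "i \<in> S" "j \<in> S"
  shows "changes_before op i = changes_before op j"
proof -
  have *: "changes_before op a = changes_before op b" if "a \<in> S" "b \<in> S" "a \<le> b" for a b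
  proof -
    have "{a..b} \<subseteq> S" using assms(1) that unfolding is_run_def by blast
    moreover have "\<forall>l\<in>S. op l = op a" using assms(1) that unfolding is_run_def by blast
    ultimately have "\<exists>c. \<forall>l\<in>{a..b}. op l = c" by (meson subsetD)
    then show ?thesis using changes_before_eq_iff_le[OF that(3)] by simp
  qed
  show ?thesis
  proof (cases "i \<le> j")
    case True
    then show ?thesis using assms by (intro *)
  next
    case False
    then have "j \<le> i" by simp
    then show ?thesis using assms by (intro *[symmetric])
  qed
qed

lemma fibre_is_run: "is_run op {j. changes_before op j = changes_before op i}"
proof -
  define S where "S = {j. changes_before op j = changes_before op i}"
  have "l \<in> S" if "a \<in> S" "b \<in> S" "l \<in> {a..b}" for a b l
  proof -
    have "changes_before op a = changes_before op b" using that by (simp add: S_def)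
    moreover have le: "a \<le> b" "a \<le> l" using that by simp_all
    ultimately obtain c where "\<forall>l\<in>{a..b}. op l = c"
      using changes_before_eq_iff_le by blast
    then have "\<forall>l'\<in>{a..l}. op l' = c" using that by auto
    then have "changes_before op a = changes_before op l"
      using changes_before_eq_iff_le[OF le(2)] by blast
    then show ?thesis using that by (simp add: S_def)
  qed
  moreover have "op a = op b" if "a \<in> S" "b \<in> S" for a b
  proof -
    have *: "op c = op d" if "c \<le> d" "changes_before op c = changes_before op d" for c d
      using that changes_before_eq_iff_le[OF that(1), of op] by (metis atLeastAtMost_iff order_refl)
    have "changes_before op a = changes_before op b" using that by (simp add: S_def)
    then show ?thesis using *[of a b] *[of b a] by (metis linorder_linear)
  qed
  moreover have "i \<in> S" by (simp add: S_def)
  ultimately show ?thesis unfolding is_run_def S_def[symmetric] by blast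
qed

text \<open>Since a run meets only one fibre of \<^term>\<open>changes_before op\<close> and each fibre is itself a run,
  the fibres are the largest runs possible.  In particular the maximal runs partition \<open>\<int>\<close>.\<close>

lemma maximal_runs_eq_fibres:
  "{S. is_maximal_run op S} = range (\<lambda>i. {j. changes_before op j = changes_before op i})"
proof -
  have sub: "S \<subseteq> {j. changes_before op j = changes_before op i}" if "is_run op S" "i \<in> S" for S i
    using changes_before_eq_if_in_run[OF that(1)] that(2) by blast
  show ?thesis
  proof (intro equalityI subsetI)
    fix S assume "S \<in> {S. is_maximal_run op S}"
    then have S: "is_run op S" "\<And>R'. is_run op R' \<Longrightarrow> S \<subseteq> R' \<Longrightarrow> R' = S"
      by (auto simp: is_maximal_run_def)
    then obtain i where "i \<in> S" by (auto simp: is_run_def)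
    then have "{j. changes_before op j = changes_before op i} = S"
      using S sub fibre_is_run by blast
    then show "S \<in> range (\<lambda>i. {j. changes_before op j = changes_before op i})" by blast
  next
    fix S assume "S \<in> range (\<lambda>i. {j. changes_before op j = changes_before op i})"
    then obtain i where S: "S = {j. changes_before op j = changes_before op i}" by blast
    have "R' = S" if "is_run op R'" "S \<subseteq> R'" for R'
      using sub[OF that(1), of i] that S by blast
    then show "S \<in> {S. is_maximal_run op S}"
      using fibre_is_run[of op i] S by (auto simp: is_maximal_run_def)
  qed
qed

text \<open>A maximal run is determined by the set of changes to its left, a subset of
  \<^term>\<open>op_changes op\<close>.\<close>

lemma finite_maximal_runs:
  assumes "finite (op_changes op)"
  shows "finite {S. is_maximal_run op S}"
proof -
  have "range (changes_before op) \<subseteq> Pow (op_changes op)"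
    by (auto simp: changes_before_def)
  then have "finite (range (changes_before op))"
    using assms by (metis finite_Pow_iff finite_subset)
  moreover have "{S. is_maximal_run op S}
      = (\<lambda>c. {j. changes_before op j = c}) ` range (changes_before op)"
    by (simp add: maximal_runs_eq_fibres image_image)
  ultimately show ?thesis by simp
qed

lemma infinite_maximal_runs:
  assumes "has_run_lengths op J \<kappa>" "infinite J"
  shows "infinite {S. is_maximal_run op S}"
  using assms bij_betw_finite unfolding has_run_lengths_def by blast

lemma op_const_if_single_run:
  assumes "has_run_lengths op {j} \<kappa>"
  shows "op i = op 0"
proof -
  obtain R where R: "bij_betw R {j} {S. is_maximal_run op S}"
    using assms unfolding has_run_lengths_def by blast
  then have "{R j} = range (\<lambda>c. {l. changes_before op l = changes_before op c})"
    unfolding maximal_runs_eq_fibres by (simp add: bij_betw_def)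
  then have "{l. changes_before op l = changes_before op c} = R j" for c
    by (metis rangeI singletonD)
  then have "i \<in> R j" "0 \<in> R j" by blast+
  moreover have "is_run op (R j)" using R by (auto simp: bij_betw_def is_maximal_run_def)
  ultimately show ?thesis unfolding is_run_def by blast
qed

section \<open>Fixed points of infinite chains\<close>

lemma infinite_chain_fixed_iff:
  "infinite_chain op x = x \<longleftrightarrow> (\<forall>i. x i = apply_op (op i) (x (i - 1)) (x (i + 1)))"
  by (auto simp: infinite_chain_def fun_eq_iff)

text \<open>If two neighbours share the operator AND, then neither can be \<open>1\<close> without the other; for OR,
  neither can be \<open>0\<close> without the other.\<close>

lemma fixed_point_eq_if_op_eq:
  assumes "infinite_chain op x = x" "op i = op (i + 1)"
  shows "x i = x (i + 1)"
proof -
  have "x i = apply_op (op i) (x (i - 1)) (x (i + 1))"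
    "x (i + 1) = apply_op (op i) (x i) (x (i + 1 + 1))"
    using assms(1)[unfolded infinite_chain_fixed_iff, rule_format, of i]
      assms(1)[unfolded infinite_chain_fixed_iff, rule_format, of "i + 1"] assms(2)
    by simp_all
  then show ?thesis by (cases "op i") auto
qed

lemma fixed_point_const_on_run:
  assumes "infinite_chain op x = x" "i \<le> j" "\<And>l. l \<in> {i..j} \<Longrightarrow> op l = c"
  shows "x j = x i"
  using assms(2,3)
proof (induction j rule: int_ge_induct)
  case base
  show ?case by simp
next
  case (step j)
  have "op j = op (j + 1)" using step by simp
  with step fixed_point_eq_if_op_eq[OF assms(1), of j] show ?case by simp
qed

lemma const_state_fixed: "infinite_chain op (\<lambda>_. c) = (\<lambda>_. c)"
  unfolding infinite_chain_fixed_iff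
proof
  fix i show "c = apply_op (op i) c c" by (cases "op i") auto
qed

text \<open>The state is \<open>1\<close> on the side of the OR: at the jump the OR sees a neighbour \<open>1\<close> and the AND a
  neighbour \<open>0\<close>, while every other variable sees its own value on both sides.\<close>

lemma jump_state_fixed:
  assumes "op p \<noteq> op (p + 1)"
  shows "infinite_chain op (\<lambda>i. (i \<le> p) = (op p = OR)) = (\<lambda>i. (i \<le> p) = (op p = OR))"
  unfolding infinite_chain_fixed_iff
proof
  fix i
  consider "i < p" | "i = p" | "i = p + 1" | "i > p + 1" by linarith
  then show "((i \<le> p) = (op p = OR)) =
    apply_op (op i) ((i - 1 \<le> p) = (op p = OR)) ((i + 1 \<le> p) = (op p = OR))"
    using assms by cases (cases "op i"; cases "op p"; cases "op (p + 1)"; auto)+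
qed

lemma infinite_chain_F_infinite:
  assumes "infinite {S. is_maximal_run op S}"
  shows "infinite_chain_F op = \<infinity>"
proof -
  let ?J = "\<lambda>p i. (i \<le> p) = (op p = OR)"
  have "inj_on ?J (op_changes op)"
  proof (rule inj_onI)
    fix p q assume eq: "?J p = ?J q"
    \<comment> \<open>The position of the jump can be read off from the state.\<close>
    have "r = s" if "?J s r \<noteq> ?J s (r + 1)" for r s
      using that by auto
    moreover have "?J p p \<noteq> ?J p (p + 1)" by simp
    then have "?J q p \<noteq> ?J q (p + 1)"
      using fun_cong[OF eq, of p] fun_cong[OF eq, of "p + 1"] by argo
    ultimately show "p = q" by blast
  qed
  moreover have "infinite (op_changes op)" using assms finite_maximal_runs by blast
  moreover have "?J ` op_changes op \<subseteq> {x. infinite_chain op x = x}"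
    unfolding op_changes_def by (intro image_subsetI CollectI jump_state_fixed) simp
  ultimately have "infinite {x. infinite_chain op x = x}"
    using finite_imageD finite_subset by blast
  then show ?thesis by (simp add: infinite_chain_F_def num_fixed_points_def ecard_def)
qed

lemma infinite_chain_F_const:
  assumes "\<And>i. op i = c"
  shows "infinite_chain_F op = 2"
proof -
  have "{x. infinite_chain op x = x} = {(\<lambda>_. False), (\<lambda>_. True)}"
  proof (intro equalityI subsetI)
    fix x assume "x \<in> {x. infinite_chain op x = x}"
    then have fx: "infinite_chain op x = x" by simp
    have "x i = x 0" for i
      using fixed_point_const_on_run[OF fx, of 0 i c] fixed_point_const_on_run[OF fx, of i 0 c]
        assms by (cases "0 \<le> i") auto
    then have "x = (\<lambda>_. x 0)" by blast
    then show "x \<in> {(\<lambda>_. False), (\<lambda>_. True)}" by (cases "x 0") auto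
  qed (auto simp: const_state_fixed)
  moreover have "(\<lambda>_::int. False) \<noteq> (\<lambda>_. True)" by (simp add: fun_eq_iff)
  ultimately have "ecard {x. infinite_chain op x = x} = enat 2"
    by (simp add: ecard_def)
  then show ?thesis
    by (simp add: infinite_chain_F_def num_fixed_points_def numeral_eq_enat)
qed

lemma ecard_eq_if_bij_betw: "bij_betw f A B \<Longrightarrow> ecard A = ecard B"
  by (simp add: ecard_def bij_betw_finite bij_betw_same_card)

text \<open>By De Morgan's laws, negating all variables maps the fixed points of a network bijectively to
  those of the network with AND and OR exchanged.\<close>

lemma infinite_chain_F_dual: "infinite_chain_F (dual_op \<circ> op) = infinite_chain_F op"
proof -
  have de_morgan: "apply_op (dual_op c) (\<not> u) (\<not> v) \<longleftrightarrow> \<not> apply_op c u v" for c u v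
    by (cases c) auto
  have fixed: "infinite_chain (dual_op \<circ> op) (Not \<circ> x) = Not \<circ> x \<longleftrightarrow> infinite_chain op x = x" for x
    by (auto simp: infinite_chain_fixed_iff de_morgan)
  have involution: "Not \<circ> (Not \<circ> x) = x" for x :: "int \<Rightarrow> bool"
    by auto
  have "bij_betw ((\<circ>) Not) {x. infinite_chain op x = x}
      {x. infinite_chain (dual_op \<circ> op) x = x}"
  proof (rule bij_betw_byWitness[where f' = "(\<circ>) Not"])
    show "(\<circ>) Not ` {x. infinite_chain (dual_op \<circ> op) x = x} \<subseteq> {x. infinite_chain op x = x}"
      using fixed involution by (metis (mono_tags, lifting) image_subsetI mem_Collect_eq)
  qed (auto simp: involution fixed)
  then show ?thesis
    by (simp add: infinite_chain_F_def num_fixed_points_def ecard_eq_if_bij_betw)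
qed

section \<open>Cutting off the two infinite runs\<close>

lemma open_chain_fixed_iff:
  assumes "n \<ge> 3" and y: "y \<in> open_chain_states n"
  shows "open_chain n op y = y \<longleftrightarrow>
    y 1 = y 2 \<and> y n = y (n - 1) \<and>
    (\<forall>i\<in>{2..n - 1}. y i = apply_op (op i) (y (i - 1)) (y (i + 1)))"
    (is "?L \<longleftrightarrow> ?R")
proof
  assume L: ?L
  have eqs: "y i = open_chain n op y i" for i using L by simp
  have "y 1 = y 2" "y n = y (n - 1)"
    using eqs[of 1] eqs[of n] assms(1) by (simp_all add: open_chain_def)
  moreover have "y i = apply_op (op i) (y (i - 1)) (y (i + 1))" if "i \<in> {2..n - 1}" for i
  proof -
    have "i \<noteq> n" "i \<in> {1..n}" "i \<noteq> 1" using that assms(1) by auto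
    then have "open_chain n op y i = apply_op (op i) (y (i - 1)) (y (i + 1))"
      by (simp add: open_chain_def)
    then show ?thesis using L by simp
  qed
  ultimately show ?R by blast
next
  assume R: ?R
  show ?L
  proof
    fix i
    consider "i \<notin> {1..n}" | "i = 1" | "i = n" | "i \<in> {2..n - 1}" using assms(1) by force
    then show "open_chain n op y i = y i"
    proof cases
      case 1
      then show ?thesis using y by (auto simp: open_chain_def open_chain_states_def PiE_def extensional_def)
    next
      case 2
      have "y 1 = y 2" using R by blast
      then show ?thesis using 2 assms(1) by (simp add: open_chain_def)
    next
      case 3
      have "y n = y (n - 1)" using R by blast
      then show ?thesis using 3 assms(1) by (simp add: open_chain_def)
    next
      case 4
      then have "y i = apply_op (op i) (y (i - 1)) (y (i + 1))" using R by blast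
      moreover have "i \<noteq> n" "i \<in> {1..n}" "i \<noteq> 1" using 4 assms(1) by auto
      then have "open_chain n op y i = apply_op (op i) (y (i - 1)) (y (i + 1))"
        by (simp add: open_chain_def)
      ultimately show ?thesis by argo
    qed
  qed
qed

text \<open>A fixed point takes only the value \<open>x a\<close> to the left of \<open>a\<close> and only \<open>x b\<close> to the right of
  \<open>b\<close>, so it is determined by its values on the window from \<open>a - 1\<close> to \<open>b + 1\<close>.  The variable with
  number \<open>i\<close> of the open chain is the variable \<open>a - 2 + i\<close> of the infinite chain, so that the two
  outermost operators of the open chain are those at \<open>a\<close> and \<open>b\<close>, each standing for a whole
  infinite run.  The inverse of restriction repeats the end values indefinitely.\<close>

lemma infinite_chain_F_eq_window:
  fixes a b :: int
  assumes "a \<le> b"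
    and left: "\<And>i. i \<le> a \<Longrightarrow> op i = c"
    and right: "\<And>i. i \<ge> b \<Longrightarrow> op i = d"
    and n: "n = nat (b - a + 3)"
    and g: "\<And>i. i \<in> {2..n - 1} \<Longrightarrow> g i = op (a - 2 + int i)"
  shows "infinite_chain_F op = num_fixed_points (open_chain_states n) (open_chain n g)"
proof -
  define cut :: "(int \<Rightarrow> bool) \<Rightarrow> nat \<Rightarrow> bool"
    where "cut x = (\<lambda>i\<in>{1..n}. x (a - 2 + int i))" for x
  define clamp :: "int \<Rightarrow> nat" where "clamp i = nat (max 1 (min (int n) (i - a + 2)))" for i
  define extend :: "(nat \<Rightarrow> bool) \<Rightarrow> int \<Rightarrow> bool" where "extend y = y \<circ> clamp" for y
  have n3: "n \<ge> 3" and nb: "int n = b - a + 3" using n assms(1) by auto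
  have clamp_left: "clamp i = 1" if "i \<le> a - 1" for i
    using that n3 unfolding clamp_def by linarith
  have clamp_right: "clamp i = n" if "i \<ge> b + 1" for i
    using that n3 nb unfolding clamp_def by linarith
  have clamp_window: "clamp i = j" if "i = a - 2 + int j" "j \<in> {1..n}" for i j
    using that by (auto simp: clamp_def)
  have cut_state: "cut x \<in> open_chain_states n" for x
    by (auto simp: cut_def open_chain_states_def)
  have cut_extend: "cut (extend y) = y" if "y \<in> open_chain_states n" for y
  proof
    fix i
    show "cut (extend y) i = y i"
      using that clamp_window[OF refl, of i]
      by (auto simp: cut_def extend_def open_chain_states_def PiE_def extensional_def)
  qed
  have extend_cut: "extend (cut x) = x" if fx: "infinite_chain op x = x" for x
  proof
    fix i
    consider "i \<le> a - 1" | "i \<ge> b + 1" | "a - 1 < i" "i < b + 1" by linarith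
    then show "extend (cut x) i = x i"
    proof cases
      case 1
      then have "extend (cut x) i = x (a - 1)"
        using n3 by (simp add: cut_def extend_def clamp_left)
      also have "\<dots> = x i"
        using 1 left by (intro fixed_point_const_on_run[OF fx, where c = c]) auto
      finally show ?thesis .
    next
      case 2
      then have "extend (cut x) i = x (a - 2 + int n)"
        using n3 by (simp add: cut_def extend_def clamp_right)
      also have "a - 2 + int n = b + 1" using nb by simp
      also have "x (b + 1) = x i"
        using 2 right by (intro fixed_point_const_on_run[OF fx, where c = d, symmetric]) auto
      finally show ?thesis .
    next
      case 3
      define j where "j = nat (i - a + 2)"
      have j: "j \<in> {1..n}" "i = a - 2 + int j" using 3 nb n3 by (auto simp: j_def)
      then show ?thesis using clamp_window[OF j(2,1)] by (simp add: cut_def extend_def)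
    qed
  qed
  have cut_fixed: "open_chain n g (cut x) = cut x" if fx: "infinite_chain op x = x" for x
  proof -
    have "x (a - 1) = x a" using fixed_point_eq_if_op_eq[OF fx, of "a - 1"] left[of "a - 1"] left[of a] by simp
    then have "cut x 1 = cut x 2" using n3 by (simp add: cut_def)
    moreover have xb: "x b = x (b + 1)" using fixed_point_eq_if_op_eq[OF fx, of b] right[of b] right[of "b + 1"] by simp
    have "a - 2 + int n = b + 1" "a - 2 + int (n - 1) = b" "n - 1 \<in> {1..n}" "n \<in> {1..n}"
      using n3 nb by auto
    then have "cut x n = cut x (n - 1)" using xb unfolding cut_def by (simp only: restrict_apply' simp_thms)
    moreover have "cut x i = apply_op (g i) (cut x (i - 1)) (cut x (i + 1))" if i: "i \<in> {2..n - 1}" for i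
    proof -
      have "cut x i = x (a - 2 + int i)" "cut x (i - 1) = x (a - 2 + int i - 1)"
        "cut x (i + 1) = x (a - 2 + int i + 1)"
        using i n3 by (auto simp: cut_def of_nat_diff algebra_simps)
      then show ?thesis
        using fx[unfolded infinite_chain_fixed_iff, rule_format, of "a - 2 + int i"] g[OF i] by simp
    qed
    ultimately show ?thesis using open_chain_fixed_iff[OF n3 cut_state] by blast
  qed
  have extend_fixed: "infinite_chain op (extend y) = extend y"
    if y: "y \<in> open_chain_states n" and fy: "open_chain n g y = y" for y
    unfolding infinite_chain_fixed_iff
  proof
    fix i
    have y12: "y 1 = y 2" and yn: "y n = y (n - 1)"
      and ymid: "\<And>i. i \<in> {2..n - 1} \<Longrightarrow> y i = apply_op (g i) (y (i - 1)) (y (i + 1))"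
      using open_chain_fixed_iff[OF n3 y, of g] fy by auto
    have idem: "apply_op c u u = u" for c u by (cases c) auto
    have l: "extend y j = y 1" if "j \<le> a" for j
    proof (cases "j = a")
      case True
      then show ?thesis using clamp_window[OF refl, of 2] y12 n3 by (simp add: extend_def)
    next
      case False
      then show ?thesis using that by (simp add: extend_def clamp_left)
    qed
    have r: "extend y j = y n" if "j \<ge> b" for j
    proof (cases "j = b")
      case True
      then have "a - 2 + int (n - 1) = j" using nb n3 by linarith
      then show ?thesis using clamp_window[OF refl, of "n - 1"] yn n3 by (auto simp: extend_def)
    next
      case False
      then show ?thesis using that by (simp add: extend_def clamp_right)
    qed
    consider "i \<le> a - 1" | "i \<ge> b + 1" | "a - 1 < i" "i < b + 1" by linarith
    then show "extend y i = apply_op (op i) (extend y (i - 1)) (extend y (i + 1))"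
    proof cases
      case 1
      then show ?thesis by (simp add: l idem)
    next
      case 2
      then show ?thesis by (simp add: r idem)
    next
      case 3
      define j where "j = nat (i - a + 2)"
      have j: "j \<in> {2..n - 1}" "i = a - 2 + int j" using 3 nb n3 by (auto simp: j_def)
      have "clamp i = j" "clamp (i - 1) = j - 1" "clamp (i + 1) = j + 1"
        using j n3 by (auto intro!: clamp_window)
      then have "extend y i = y j" "extend y (i - 1) = y (j - 1)" "extend y (i + 1) = y (j + 1)"
        unfolding extend_def by simp_all
      moreover have "g j = op i" using g[OF j(1)] j(2) by simp
      ultimately show ?thesis using ymid[OF j(1)] by simp
    qed
  qed
  have "bij_betw cut {x. infinite_chain op x = x}
      {y \<in> open_chain_states n. open_chain n g y = y}"
    by (rule bij_betw_byWitness[where f' = extend])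
      (auto simp: extend_cut cut_extend cut_state cut_fixed extend_fixed)
  then show ?thesis
    by (simp add: infinite_chain_F_def num_fixed_points_def ecard_eq_if_bij_betw)
qed

section \<open>Networks with finitely many runs\<close>

lemma dual_op_eq_iff: "b = dual_op a \<longleftrightarrow> b \<noteq> a"
  by (cases a; cases b) auto

text \<open>Translates a finite sequence of run lengths into explicit positions: \<open>s j\<close> is where the run with
  index \<open>j\<close> begins.  The maximal runs partition \<open>\<int>\<close> and are ordered from left to right, so the
  position just before \<open>s (j + 1)\<close> can only belong to the run with index \<open>j\<close>; every run in between
  the outer two is therefore the interval from \<open>s j\<close> to \<open>s (j + 1) - 1\<close>.  The operator changes at each
  \<open>s j\<close> since otherwise the two runs meeting there would lie in one fibre of
  \<^term>\<open>changes_before op\<close>.\<close>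

lemma run_starts_exist:
  fixes m :: int and k :: "int \<Rightarrow> nat"
  assumes "has_run_lengths op {0..m + 1} \<kappa>" and "m \<ge> 0"
    and \<kappa>: "\<And>j. j \<in> {1..m} \<Longrightarrow> \<kappa> j = enat (k j)"
  obtains s :: "int \<Rightarrow> int" where
    "\<And>i. i < s 1 \<Longrightarrow> op i = op (s 1 - 1)"
    "\<And>j. j \<in> {1..m} \<Longrightarrow> s j < s (j + 1)"
    "\<And>j. j \<in> {1..m} \<Longrightarrow> s (j + 1) = s j + int (k j)"
    "\<And>j i. j \<in> {1..m} \<Longrightarrow> s j \<le> i \<Longrightarrow> i < s (j + 1) \<Longrightarrow> op i = op (s j)"
    "\<And>i. i \<ge> s (m + 1) \<Longrightarrow> op i = op (s (m + 1))"
    "\<And>j. j \<in> {1..m + 1} \<Longrightarrow> op (s j - 1) \<noteq> op (s j)"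
proof -
  obtain R where bij: "bij_betw R {0..m + 1} {S. is_maximal_run op S}"
    and ord: "\<And>i j a b. i \<in> {0..m + 1} \<Longrightarrow> j \<in> {0..m + 1} \<Longrightarrow> i < j \<Longrightarrow> a \<in> R i \<Longrightarrow> b \<in> R j \<Longrightarrow> a < b"
    and len: "\<And>j. j \<in> {0..m + 1} \<Longrightarrow> ecard (R j) = \<kappa> j"
    using assms(1) unfolding has_run_lengths_def by blast
  have run: "is_run op (R j)" if "j \<in> {0..m + 1}" for j
    using bij that by (force simp: bij_betw_def is_maximal_run_def)
  have const: "op x = op y" if "j \<in> {0..m + 1}" "x \<in> R j" "y \<in> R j" for j x y
    using run[OF that(1)] that unfolding is_run_def by blast
  have ne: "R j \<noteq> {}" if "j \<in> {0..m + 1}" for j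
    using run[OF that] by (simp add: is_run_def)
  have cover: "\<exists>j\<in>{0..m + 1}. R j = {l. changes_before op l = changes_before op i}" for i
  proof -
    have "{l. changes_before op l = changes_before op i} \<in> R ` {0..m + 1}"
      using bij unfolding bij_betw_def maximal_runs_eq_fibres by simp
    then show ?thesis by (metis imageE)
  qed
  have cover': "\<exists>j\<in>{0..m + 1}. i \<in> R j" for i
    using cover[of i] by auto
  define s where "s j = (LEAST i. i \<in> R j)" for j
  \<comment> \<open>A run other than the leftmost one is bounded below by any element of its predecessor.\<close>
  have "\<exists>x\<in>R j. \<forall>y\<in>R j. x \<le> y" if j: "j \<in> {1..m + 1}" for j
  proof -
    obtain c where c: "c \<in> R (j - 1)" using ne[of "j - 1"] j by auto
    obtain d where d: "d \<in> R j" using ne[of j] j by auto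
    have lb: "c < y" if "y \<in> R j" for y
      using ord[of "j - 1" j c y] j c that by auto
    \<comment> \<open>As \<open>\<int>\<close> is not well-ordered, the minimum is found through the distance to \<open>c\<close>.\<close>
    define N where "N = (LEAST N. c + int N \<in> R j)"
    have "c + int (nat (d - c)) \<in> R j" using lb[OF d] d by simp
    then have N: "c + int N \<in> R j" unfolding N_def by (rule LeastI)
    have "c + int N \<le> y" if "y \<in> R j" for y
    proof -
      have "N \<le> nat (y - c)" unfolding N_def using lb[OF that] that by (intro Least_le) simp
      then show ?thesis using lb[OF that] by linarith
    qed
    then show ?thesis using N by blast
  qed
  then have s: "s j \<in> R j \<and> (\<forall>y\<in>R j. s j \<le> y)" if "j \<in> {1..m + 1}" for j
    using that Least_equality[of "\<lambda>i. i \<in> R j"] unfolding s_def by metis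
  have pred: "s (j + 1) - 1 \<in> R j" if j: "j \<in> {0..m}" for j
  proof -
    obtain l where l: "l \<in> {0..m + 1}" "s (j + 1) - 1 \<in> R l" using cover' by blast
    have s': "s (j + 1) \<in> R (j + 1)" "\<And>y. y \<in> R (j + 1) \<Longrightarrow> s (j + 1) \<le> y"
      using s[of "j + 1"] j by auto
    obtain c where c: "c \<in> R j" using ne[of j] j by auto
    have "l \<noteq> j + 1" using s'(2)[of "s (j + 1) - 1"] l by auto
    moreover have "\<not> l > j + 1"
      using ord[of "j + 1" l "s (j + 1)" "s (j + 1) - 1"] l s' j by auto
    moreover have "\<not> l < j"
      using ord[of l j "s (j + 1) - 1" c] ord[of j "j + 1" c "s (j + 1)"] l s' j c by auto
    ultimately have "l = j" by linarith
    then show ?thesis using l by simp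
  qed
  have interval: "R j = {s j..<s (j + 1)}" if j: "j \<in> {1..m}" for j
  proof
    show "R j \<subseteq> {s j..<s (j + 1)}"
      using s[of j] s[of "j + 1"] ord[of j "j + 1" _ "s (j + 1)"] j by auto
    have "{s j..s (j + 1) - 1} \<subseteq> R j"
      using run[of j] s[of j] pred[of j] j unfolding is_run_def by auto
    then show "{s j..<s (j + 1)} \<subseteq> R j" by auto
  qed
  have first: "i \<in> R 0" if "i < s 1" for i
  proof -
    obtain l where l: "l \<in> {0..m + 1}" "i \<in> R l" using cover' by blast
    have "l \<noteq> 1" using s[of 1] l that assms(2) by force
    moreover have "\<not> l > 1" using ord[of 1 l "s 1" i] s[of 1] l that assms(2) by auto
    ultimately have "l = 0" using l by auto
    then show ?thesis using l by simp
  qed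
  have last: "i \<in> R (m + 1)" if "i \<ge> s (m + 1)" for i
  proof -
    obtain l where l: "l \<in> {0..m + 1}" "i \<in> R l" using cover' by blast
    have "\<not> l < m + 1" using ord[of l "m + 1" i "s (m + 1)"] s[of "m + 1"] l that assms(2) by auto
    then have "l = m + 1" using l by auto
    then show ?thesis using l by simp
  qed
  have increasing: "s j < s (j + 1)" if "j \<in> {1..m}" for j
    using s[of j] interval[OF that] that by auto
  show ?thesis
  proof (rule that[of s])
    show "s j < s (j + 1)" if "j \<in> {1..m}" for j using increasing[OF that] .
    show "op i = op (s 1 - 1)" if "i < s 1" for i
      by (rule const[of 0]) (use first that assms(2) in auto)
    show "s (j + 1) = s j + int (k j)" if j: "j \<in> {1..m}" for j
    proof -
      have "ecard {s j..<s (j + 1)} = enat (k j)" using len[of j] \<kappa>[OF j] interval[OF j] j by simp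
      then have "nat (s (j + 1) - s j) = k j" by (simp add: ecard_def)
      moreover have "s j < s (j + 1)" using increasing[OF j] .
      ultimately show ?thesis by linarith
    qed
    show "op i = op (s j)" if "j \<in> {1..m}" "s j \<le> i" "i < s (j + 1)" for j i
      by (rule const[of j]) (use interval[OF that(1)] that in auto)
    show "op i = op (s (m + 1))" if "i \<ge> s (m + 1)" for i
      by (rule const[of "m + 1"]) (use last that assms(2) in auto)
    show "op (s j - 1) \<noteq> op (s j)" if j: "j \<in> {1..m + 1}" for j
    proof
      assume eq: "op (s j - 1) = op (s j)"
      have "l = s j \<or> l = s j - 1" if "l \<in> {s j - 1..s j}" for l using that by auto
      then have same: "changes_before op (s j - 1) = changes_before op (s j)"
        using changes_before_eq_iff_le[of "s j - 1" "s j" op] eq by fastforce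
      obtain l where l: "l \<in> {0..m + 1}" "s j - 1 \<in> R l" "s j \<in> R l"
        using cover[of "s j"] same by auto
      have "s j - 1 \<in> R (j - 1)" using pred[of "j - 1"] j by simp
      then have "l \<noteq> j" using s[of j] j l by force
      then show False
        using ord[of l j "s j" "s j"] ord[of j l "s j" "s j"] s[of j] l j by force
    qed
  qed
qed

text \<open>The position of \<open>s (m + 1)\<close> is part of the claim because it is obtained by the same downward
  induction on \<open>j\<close>; the final \<open>1\<close> in the list accounts for the first operator of the last run.\<close>

lemma run_operators_nth:
  assumes start: "\<And>j. j \<in> {1..m} \<Longrightarrow> s (j + 1) = s j + int (k j)"
    and const: "\<And>j i. j \<in> {1..m} \<Longrightarrow> s j \<le> i \<Longrightarrow> i < s (j + 1) \<Longrightarrow> op i = op (s j)"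
    and alt: "\<And>j. j \<in> {1..m} \<Longrightarrow> op (s (j + 1)) = dual_op (op (s j))"
    and "1 \<le> j" "j \<le> m + 1"
  shows "s (m + 1) = s j + int (sum_list (map k [j..m]))
    \<and> (\<forall>i \<le> sum_list (map k [j..m]).
         run_operators (op (s j)) (map k [j..m] @ [1]) ! i = op (s j + int i))"
  using assms(5,4)
proof (induction j rule: int_le_induct)
  case base
  show ?case by simp
next
  case (step i)
  define j where "j = i - 1"
  have j: "j \<in> {1..m}" "i = j + 1" using step by (auto simp: j_def)
  have upt: "[j..m] = j # [j + 1..m]" using j by (simp add: upto_rec1)
  have IH1: "s (m + 1) = s (j + 1) + int (sum_list (map k [j + 1..m]))"
    and IH2: "\<And>i. i \<le> sum_list (map k [j + 1..m]) \<Longrightarrow>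
      run_operators (op (s (j + 1))) (map k [j + 1..m] @ [1]) ! i = op (s (j + 1) + int i)"
    using step.IH step.prems j by auto
  have "run_operators (op (s j)) (map k [j..m] @ [1]) ! l = op (s j + int l)"
    if l: "l \<le> sum_list (map k [j..m])" for l
  proof (cases "l < k j")
    case True
    then have "op (s j + int l) = op (s j)"
      using start[OF j(1)] by (intro const[OF j(1)]) auto
    then show ?thesis using True by (simp add: upt nth_append)
  next
    case False
    then have "run_operators (op (s j)) (map k [j..m] @ [1]) ! l
      = run_operators (op (s (j + 1))) (map k [j + 1..m] @ [1]) ! (l - k j)"
      using alt[OF j(1)] by (simp add: upt nth_append)
    also have "\<dots> = op (s (j + 1) + int (l - k j))"
      using l by (intro IH2) (simp add: upt)
    also have "s (j + 1) + int (l - k j) = s j + int l"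
      using False start[OF j(1)] by simp
    finally show ?thesis .
  qed
  then show ?case using IH1 start[OF j(1)] by (simp add: upt j_def[symmetric])
qed

text \<open>Each of the two infinite runs is represented in the open chain by the single operator next to
  its finite neighbour, which is why a \<open>1\<close> is put at either end of the list.\<close>

lemma infinite_chain_F_eq_open_chain_F:
  assumes "has_run_lengths op {0..m + 1} \<kappa>" and m: "m \<ge> 0"
    and \<kappa>: "\<And>j. j \<in> {1..m} \<Longrightarrow> \<kappa> j = enat (k j)"
  shows "infinite_chain_F op = open_chain_F a ([1] @ map k [1..m] @ [1])"
proof -
  obtain s where s: "\<And>i. i < s 1 \<Longrightarrow> op i = op (s 1 - 1)"
    "\<And>j. j \<in> {1..m} \<Longrightarrow> s j < s (j + 1)"
    "\<And>j. j \<in> {1..m} \<Longrightarrow> s (j + 1) = s j + int (k j)"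
    "\<And>j i. j \<in> {1..m} \<Longrightarrow> s j \<le> i \<Longrightarrow> i < s (j + 1) \<Longrightarrow> op i = op (s j)"
    "\<And>i. i \<ge> s (m + 1) \<Longrightarrow> op i = op (s (m + 1))"
    "\<And>j. j \<in> {1..m + 1} \<Longrightarrow> op (s j - 1) \<noteq> op (s j)"
    using run_starts_exist[where op = op and m = m and k = k, OF assms] by blast
  \<comment> \<open>Dualising if necessary, the leftmost run may be taken to consist of the operator \<open>a\<close>.\<close>
  define op' where "op' = (if op (s 1 - 1) = a then op else dual_op \<circ> op)"
  have F: "infinite_chain_F op' = infinite_chain_F op"
    by (simp add: op'_def infinite_chain_F_dual)
  have op'_eq: "op' i = op' j \<longleftrightarrow> op i = op j" for i j
    by (auto simp: op'_def dual_op_eq_iff) (metis dual_op_eq_iff)+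
  have a: "op' (s 1 - 1) = a"
    by (auto simp: op'_def) (metis dual_op_eq_iff)
  have alt: "op' (s (j + 1)) = dual_op (op' (s j))" if j: "j \<in> {1..m}" for j
  proof -
    have "op' (s (j + 1) - 1) = op' (s j)"
      unfolding op'_eq by (rule s(4)[OF j]) (use s(2)[OF j] in simp_all)
    then show ?thesis using s(6)[of "j + 1"] j op'_eq dual_op_eq_iff by force
  qed
  have const: "op' i = op' (s j)" if "j \<in> {1..m}" "s j \<le> i" "i < s (j + 1)" for i j
    unfolding op'_eq by (rule s(4)[OF that])
  note nth = run_operators_nth[where op = op' and s = s and m = m and k = k and j = 1, OF s(3) const alt]
  let ?K = "sum_list (map k [1..m])"
  have last_start: "s (m + 1) = s 1 + int ?K"
    and nth': "\<And>i. i \<le> ?K \<Longrightarrow> run_operators (op' (s 1)) (map k [1..m] @ [1]) ! i = op' (s 1 + int i)"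
    using nth m by auto
  have "op (s 1 - 1) \<noteq> op (s 1)" using m by (intro s(6)) simp
  then have dual: "dual_op a = op' (s 1)" using a op'_eq dual_op_eq_iff by metis
  have ops: "run_operators a ([1] @ map k [1..m] @ [1]) ! (i - 2) = op' (s 1 - 1 - 2 + int i)"
    if i: "i \<in> {2..?K + 3}" for i
  proof (cases "i = 2")
    case True
    then show ?thesis using a by simp
  next
    case False
    then have "run_operators a ([1] @ map k [1..m] @ [1]) ! (i - 2)
      = run_operators (op' (s 1)) (map k [1..m] @ [1]) ! (i - 3)"
      using i by (simp add: nth_Cons' dual)
    also have "\<dots> = op' (s 1 + int (i - 3))" using i by (intro nth') auto
    also have "s 1 + int (i - 3) = s 1 - 1 - 2 + int i" using i False by auto
    finally show ?thesis .
  qed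
  have "infinite_chain_F op' = num_fixed_points (open_chain_states (?K + 4))
      (open_chain (?K + 4) (\<lambda>i. run_operators a ([1] @ map k [1..m] @ [1]) ! (i - 2)))"
  proof (rule infinite_chain_F_eq_window[where a = "s 1 - 1" and b = "s (m + 1)"])
    show "op' i = op' (s 1 - 1)" if "i \<le> s 1 - 1" for i
      unfolding op'_eq by (rule s(1)) (use that in simp)
    show "op' i = op' (s (m + 1))" if "i \<ge> s (m + 1)" for i
      unfolding op'_eq by (rule s(5)) (use that in simp)
    show "run_operators a ([1] @ map k [1..m] @ [1]) ! (i - 2) = op' (s 1 - 1 - 2 + int i)"
      if "i \<in> {2..?K + 4 - 1}" for i
      using that by (intro ops) simp
  qed (use last_start in auto)
  moreover have "sum_list ([1] @ map k [1..m] @ [1]) + 2 = ?K + 4" by simp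
  ultimately show ?thesis unfolding F open_chain_F_def Let_def by argo
qed

theorem theorem3p1:
  fixes k :: "int \<Rightarrow> nat" and m :: int
  assumes "\<And>i. k i \<ge> 1" and "m \<ge> 1"
  shows
    "(\<forall>op. has_run_lengths op {0} (\<lambda>_. \<infinity>) \<longrightarrow> infinite_chain_F op = 2)
   \<and> (\<forall>op a. has_run_lengths op {0..m + 1} (\<lambda>i. if i = 0 \<or> i = m + 1 then \<infinity> else enat (k i)) \<longrightarrow>
        infinite_chain_F op = open_chain_F a ([1] @ map k [1..m] @ [1]))
   \<and> (\<forall>op. has_run_lengths op {0..} (\<lambda>i. if i = 0 then \<infinity> else enat (k i)) \<longrightarrow>
        infinite_chain_F op = \<infinity>)
   \<and> (\<forall>op. has_run_lengths op {..0} (\<lambda>i. if i = 0 then \<infinity> else enat (k i)) \<longrightarrow>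
        infinite_chain_F op = \<infinity>)
   \<and> (\<forall>op. has_run_lengths op UNIV (\<lambda>i. enat (k i)) \<longrightarrow>
        infinite_chain_F op = \<infinity>)"
proof (intro conjI allI impI)
  show "infinite_chain_F op = 2" if "has_run_lengths op {0} (\<lambda>_. \<infinity>)" for op
    using infinite_chain_F_const op_const_if_single_run[OF that] by blast
  show "infinite_chain_F op = open_chain_F a ([1] @ map k [1..m] @ [1])"
    if "has_run_lengths op {0..m + 1} (\<lambda>i. if i = 0 \<or> i = m + 1 then \<infinity> else enat (k i))" for op a
    using assms(2) by (intro infinite_chain_F_eq_open_chain_F[OF that]) auto
  have infinitely_many: "infinite_chain_F op = \<infinity>"
    if "has_run_lengths op J \<kappa>" "infinite J" for op J \<kappa>
    by (intro infinite_chain_F_infinite infinite_maximal_runs[OF that])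
  show "infinite_chain_F op = \<infinity>"
    if "has_run_lengths op {0..} (\<lambda>i. if i = 0 then \<infinity> else enat (k i))" for op
    by (rule infinitely_many[OF that infinite_Ici])
  show "infinite_chain_F op = \<infinity>"
    if "has_run_lengths op {..0} (\<lambda>i. if i = 0 then \<infinity> else enat (k i))" for op
    by (rule infinitely_many[OF that infinite_Iic])
  show "infinite_chain_F op = \<infinity>" if "has_run_lengths op UNIV (\<lambda>i. enat (k i))" for op
    by (rule infinitely_many[OF that infinite_UNIV_int])
qed

end
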